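(* If $Q$ is a finite nonassociative extra loop, then $16$ divides $|Q|$.
   Context: A loop is a set $Q$ with a binary operation having a two-sided identity $1$ such that all equations $xu=y$ and $vx=y$ have unique solutions $u,v$. A loop $Q$ is conjugacy closed (a CC-loop) if there are functions $f,g:Q\times Q\to Q$ such that for all $x,y,z\in Q$: $x(yz)=f(x,y)(xz)$ and $(zy)x=(zx)g(x,y)$. An extra loop is a CC-loop which is diassociative, i.e. every subloop $\langle x,y\rangle$ generated by two elements is a group (for CC-loops this is equivalent to being Moufang). *)

theory Defs
  imports "HOL-Algebra.Group"
begin

locale loop =
  fixes Q (structure)
  assumes m_closed: "\<lbrakk>x \<in> carrier Q; y \<in> carrier Q\<rbrakk> \<Longrightarrow> x \<otimes> y \<in> carrier Q"
    and one_closed: "\<one> \<in> carrier Q"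
    and l_one: "x \<in> carrier Q \<Longrightarrow> \<one> \<otimes> x = x"
    and r_one: "x \<in> carrier Q \<Longrightarrow> x \<otimes> \<one> = x"
    and l_div: "\<lbrakk>x \<in> carrier Q; y \<in> carrier Q\<rbrakk> \<Longrightarrow> \<exists>!u. u \<in> carrier Q \<and> x \<otimes> u = y"
    and r_div: "\<lbrakk>x \<in> carrier Q; y \<in> carrier Q\<rbrakk> \<Longrightarrow> \<exists>!v. v \<in> carrier Q \<and> v \<otimes> x = y"

locale cc_loop = loop +
  assumes l_conj: "\<exists>f \<in> carrier Q \<rightarrow> carrier Q \<rightarrow> carrier Q.
      \<forall>x \<in> carrier Q. \<forall>y \<in> carrier Q. \<forall>z \<in> carrier Q. x \<otimes> (y \<otimes> z) = f x y \<otimes> (x \<otimes> z)"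
    and r_conj: "\<exists>g \<in> carrier Q \<rightarrow> carrier Q \<rightarrow> carrier Q.
      \<forall>x \<in> carrier Q. \<forall>y \<in> carrier Q. \<forall>z \<in> carrier Q. (z \<otimes> y) \<otimes> x = (z \<otimes> x) \<otimes> g x y"

(* Requiring the identity of Q is no restriction: an identity e of the restricted operation
   satisfies e * e = e, hence is the identity of Q by unique solvability. *)
definition subloop :: "'a set \<Rightarrow> ('a, 'b) monoid_scheme \<Rightarrow> bool" where
  "subloop H Q \<longleftrightarrow> H \<subseteq> carrier Q \<and> loop (Q\<lparr>carrier := H\<rparr>)"

definition subloop_generated :: "('a, 'b) monoid_scheme \<Rightarrow> 'a set \<Rightarrow> 'a set" where
  "subloop_generated Q S = \<Inter> {H. subloop H Q \<and> S \<subseteq> H}"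

locale extra_loop = cc_loop +
  assumes diassociative:
    "\<lbrakk>x \<in> carrier Q; y \<in> carrier Q\<rbrakk> \<Longrightarrow> group (Q\<lparr>carrier := subloop_generated Q {x, y}\<rparr>)"

end

(* Left and right conjugacy closure together with diassociativity give the extra loop
   identities and the Moufang identity, which force all squares into the nucleus N. As N is
   normal, Q/N is an elementary abelian 2-group. By diassociativity Q/N is not generated by two
   elements when Q is nonassociative, so 8 divides |Q/N|. Associators lie in N, depend only on
   the classes of their arguments modulo N and are symmetric in them; this symmetry makes every
   associator square to 1, so |N| is even. Finally |Q| = |N| |Q/N|. *)
theory Submission
  imports Defs "HOL-Algebra.Sylow" "HOL-Algebra.Multiplicative_Group"
begin

section \<open>Loops: cancellation, inverses, generated subloops\<close>

context loop
begin

declare m_closed [simp, intro] one_closed [simp, intro] l_one [simp] r_one [simp]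

lemma l_cancel:
  assumes "x \<in> carrier Q" "y \<in> carrier Q" "z \<in> carrier Q"
  shows "x \<otimes> y = x \<otimes> z \<longleftrightarrow> y = z"
  using l_div[of x "x \<otimes> y"] assms by (metis m_closed)

lemma r_cancel:
  assumes "x \<in> carrier Q" "y \<in> carrier Q" "z \<in> carrier Q"
  shows "y \<otimes> x = z \<otimes> x \<longleftrightarrow> y = z"
  using r_div[of x "y \<otimes> x"] assms by (metis m_closed)

text \<open>The description behind \<open>m_inv\<close> needs uniqueness, which comes from left
  cancellation instead of associativity.\<close>

lemma inv_equality:
  assumes "x \<in> carrier Q" "y \<in> carrier Q" "x \<otimes> y = \<one>" "y \<otimes> x = \<one>"
  shows "inv x = y"
  unfolding m_inv_def using assms by (intro the_equality) (auto, metis l_cancel)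

text \<open>Keeps the intersection in \<open>subloop_generated\<close> from ranging over the empty
  family, where it would be the universal set.\<close>

lemma subloop_carrier: "subloop (carrier Q) Q"
proof -
  have "Q\<lparr>carrier := carrier Q\<rparr> = Q" by (cases Q) simp
  then show ?thesis unfolding subloop_def using loop_axioms by simp
qed

lemma subloop_generated_subset:
  "S \<subseteq> carrier Q \<Longrightarrow> subloop_generated Q S \<subseteq> carrier Q"
  unfolding subloop_generated_def using subloop_carrier by blast

end

lemma subloop_generated_incl: "S \<subseteq> subloop_generated Q S"
  unfolding subloop_generated_def by blast

section \<open>Diassociativity: identities in two variables\<close>

context extra_loop
begin

text \<open>Diassociativity as an elimination rule in terms of \<open>Q\<close> alone: inside
  \<open>H\<close> products associate, so word identities in \<open>x\<close>, \<open>y\<close> and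
  their inverses follow automatically.\<close>

lemma two_generated:
  assumes x: "x \<in> carrier Q" and y: "y \<in> carrier Q"
  obtains H where "x \<in> H" "y \<in> H" "inv x \<in> H" "inv y \<in> H" "H \<subseteq> carrier Q"
    "inv x \<otimes> x = \<one>" "x \<otimes> inv x = \<one>" "inv y \<otimes> y = \<one>" "y \<otimes> inv y = \<one>"
    "\<And>a b. a \<in> H \<Longrightarrow> b \<in> H \<Longrightarrow> a \<otimes> b \<in> H"
    "\<And>a b c. a \<in> H \<Longrightarrow> b \<in> H \<Longrightarrow> c \<in> H \<Longrightarrow> (a \<otimes> b) \<otimes> c = a \<otimes> (b \<otimes> c)"
proof -
  let ?H = "subloop_generated Q {x, y}"
  interpret H: group "Q\<lparr>carrier := ?H\<rparr>" using diassociative x y .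
  have sub: "?H \<subseteq> carrier Q" using subloop_generated_subset x y by simp
  have inc: "x \<in> ?H" "y \<in> ?H" using subloop_generated_incl[of "{x, y}"] by auto
  have inv: "inv a \<in> ?H \<and> inv a \<otimes> a = \<one> \<and> a \<otimes> inv a = \<one>" if a: "a \<in> ?H" for a
  proof -
    from a H.r_inv_ex[of a] H.l_inv_ex[of a] obtain b where b: "b \<in> ?H" "a \<otimes> b = \<one>" "b \<otimes> a = \<one>"
      using H.inv_closed[of a] H.r_inv[of a] H.l_inv[of a] by auto
    \<comment> \<open>\<open>b\<close> is a two-sided inverse in \<open>Q\<close> as well, so the
      inverse of the subgroup agrees with that of \<open>Q\<close>.\<close>
    then have "inv a = b" using inv_equality a sub by blast
    with b show ?thesis by simp
  qed
  show thesis
    using that[of ?H] inc inv sub H.m_closed H.m_assoc by simp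
qed

lemma inv_closed [simp, intro]: "x \<in> carrier Q \<Longrightarrow> inv x \<in> carrier Q"
  by (rule two_generated[of x x]) auto

lemma l_inv [simp]: "x \<in> carrier Q \<Longrightarrow> inv x \<otimes> x = \<one>"
  by (rule two_generated[of x x]) auto

lemma r_inv [simp]: "x \<in> carrier Q \<Longrightarrow> x \<otimes> inv x = \<one>"
  by (rule two_generated[of x x]) auto

lemma inv_inv [simp]: "x \<in> carrier Q \<Longrightarrow> inv (inv x) = x"
  by (rule inv_equality) auto

lemma inverse_property [simp]:
  assumes "x \<in> carrier Q" "y \<in> carrier Q"
  shows "inv x \<otimes> (x \<otimes> y) = y" "x \<otimes> (inv x \<otimes> y) = y"
    "(y \<otimes> x) \<otimes> inv x = y" "(y \<otimes> inv x) \<otimes> x = y"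
proof -
  obtain H where H: "x \<in> H" "y \<in> H" "inv x \<in> H"
    "\<And>a b c. a \<in> H \<Longrightarrow> b \<in> H \<Longrightarrow> c \<in> H \<Longrightarrow> (a \<otimes> b) \<otimes> c = a \<otimes> (b \<otimes> c)"
    using two_generated[OF assms] by metis
  show "inv x \<otimes> (x \<otimes> y) = y" "x \<otimes> (inv x \<otimes> y) = y"
    "(y \<otimes> x) \<otimes> inv x = y" "(y \<otimes> inv x) \<otimes> x = y"
    using H(4)[symmetric, of "inv x" x y] H(4)[symmetric, of x "inv x" y]
      H(4)[of y x "inv x"] H(4)[of y "inv x" x] H(1-3) assms by simp_all
qed

lemma l_solve:
  assumes "x \<in> carrier Q" "y \<in> carrier Q" "x \<otimes> y = z"
  shows "y = inv x \<otimes> z"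
  using assms by auto

lemma r_solve:
  assumes "x \<in> carrier Q" "y \<in> carrier Q" "y \<otimes> x = z"
  shows "y = z \<otimes> inv x"
  using assms by auto

lemma inv_mult:
  assumes "x \<in> carrier Q" "y \<in> carrier Q"
  shows "inv (x \<otimes> y) = inv y \<otimes> inv x"
proof -
  have "inv y = inv (x \<otimes> y) \<otimes> x"
    using assms inverse_property(3)[of y x] inverse_property(1)[of "x \<otimes> y" "inv y"] by simp
  then show ?thesis using assms by simp
qed

lemma flexible:
  assumes "x \<in> carrier Q" "y \<in> carrier Q"
  shows "(x \<otimes> y) \<otimes> x = x \<otimes> (y \<otimes> x)"
  by (rule two_generated[OF assms]) auto

lemma flexible_inv:
  assumes "x \<in> carrier Q" "y \<in> carrier Q"
  shows "(x \<otimes> y) \<otimes> inv x = x \<otimes> (y \<otimes> inv x)"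
  by (rule two_generated[OF assms]) auto

lemma l_alt:
  assumes "x \<in> carrier Q" "y \<in> carrier Q"
  shows "(x \<otimes> x) \<otimes> y = x \<otimes> (x \<otimes> y)"
  by (rule two_generated[OF assms]) auto

lemma r_alt:
  assumes "x \<in> carrier Q" "y \<in> carrier Q"
  shows "(y \<otimes> x) \<otimes> x = y \<otimes> (x \<otimes> x)"
  by (rule two_generated[OF assms]) auto

lemma square_product:
  assumes "x \<in> carrier Q" "y \<in> carrier Q"
  shows "(x \<otimes> y) \<otimes> (x \<otimes> y) = x \<otimes> (y \<otimes> (x \<otimes> y))"
  by (rule two_generated[OF assms]) auto

section \<open>Conjugacy closure: extra and Moufang identities\<close>

text \<open>Setting \<open>z\<close> to the identity in the conjugacy law determines
  \<open>f x y\<close>: it is the conjugate of \<open>y\<close> by \<open>x\<close>.\<close>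

lemma l_conj_eq:
  assumes "x \<in> carrier Q" "y \<in> carrier Q" "z \<in> carrier Q"
  shows "x \<otimes> (y \<otimes> z) = ((x \<otimes> y) \<otimes> inv x) \<otimes> (x \<otimes> z)"
proof -
  obtain f where f: "f \<in> carrier Q \<rightarrow> carrier Q \<rightarrow> carrier Q"
    "\<forall>x \<in> carrier Q. \<forall>y \<in> carrier Q. \<forall>z \<in> carrier Q. x \<otimes> (y \<otimes> z) = f x y \<otimes> (x \<otimes> z)"
    using l_conj by blast
  have c: "f x y \<in> carrier Q" using f(1) assms by blast
  have "x \<otimes> (y \<otimes> \<one>) = f x y \<otimes> (x \<otimes> \<one>)" using f(2) assms by blast
  then have "f x y = (x \<otimes> y) \<otimes> inv x" using assms c by simp
  then show ?thesis using f(2) assms by metis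
qed

lemma r_conj_eq:
  assumes "x \<in> carrier Q" "y \<in> carrier Q" "z \<in> carrier Q"
  shows "(z \<otimes> y) \<otimes> x = (z \<otimes> x) \<otimes> (inv x \<otimes> (y \<otimes> x))"
proof -
  obtain f where f: "f \<in> carrier Q \<rightarrow> carrier Q \<rightarrow> carrier Q"
    "\<forall>x \<in> carrier Q. \<forall>y \<in> carrier Q. \<forall>z \<in> carrier Q. (z \<otimes> y) \<otimes> x = (z \<otimes> x) \<otimes> f x y"
    using r_conj by blast
  have c: "f x y \<in> carrier Q" using f(1) assms by blast
  have "(\<one> \<otimes> y) \<otimes> x = (\<one> \<otimes> x) \<otimes> f x y" using f(2) assms by blast
  then have "f x y = inv x \<otimes> (y \<otimes> x)" using assms c by simp
  then show ?thesis using f(2) assms by metis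
qed

text \<open>The conjugate of \<open>y \<otimes> x\<close> by \<open>x\<close> is
  \<open>x \<otimes> y\<close>, so this is \<open>l_conj_eq\<close> at \<open>y \<otimes> x\<close>.
  With its mirror image \<open>extra_right\<close> and with \<open>extra_middle\<close> it forms the
  three classical extra loop identities.\<close>

lemma extra_left:
  assumes "x \<in> carrier Q" "y \<in> carrier Q" "z \<in> carrier Q"
  shows "(x \<otimes> y) \<otimes> (x \<otimes> z) = x \<otimes> ((y \<otimes> x) \<otimes> z)"
  using l_conj_eq[of x "y \<otimes> x" z] assms by (simp add: flexible[symmetric])

lemma extra_right:
  assumes "x \<in> carrier Q" "y \<in> carrier Q" "z \<in> carrier Q"
  shows "(z \<otimes> x) \<otimes> (y \<otimes> x) = (z \<otimes> (x \<otimes> y)) \<otimes> x"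
  using r_conj_eq[of x "x \<otimes> y" z] assms by (simp add: flexible)

text \<open>An autotopism: \<open>x\<close> on the left of \<open>u\<close> and \<open>inv x\<close>
  on the right of \<open>v\<close> act jointly on \<open>u \<otimes> v\<close>. In
  \<open>extra_left\<close> take \<open>y = (u \<otimes> v) \<otimes> inv x\<close> and
  \<open>z = inv v\<close>, so that the inner product collapses to \<open>u\<close>; then divide by
  \<open>x \<otimes> inv v\<close>, whose inverse is \<open>v \<otimes> inv x\<close>.\<close>

lemma l_r_inv_mult:
  assumes "x \<in> carrier Q" "u \<in> carrier Q" "v \<in> carrier Q"
  shows "(x \<otimes> u) \<otimes> (v \<otimes> inv x) = (x \<otimes> (u \<otimes> v)) \<otimes> inv x"
proof -
  have "(x \<otimes> ((u \<otimes> v) \<otimes> inv x)) \<otimes> (x \<otimes> inv v) = x \<otimes> u"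
    using extra_left[of x "(u \<otimes> v) \<otimes> inv x" "inv v"] assms by simp
  then have "x \<otimes> ((u \<otimes> v) \<otimes> inv x) = (x \<otimes> u) \<otimes> inv (x \<otimes> inv v)"
    using assms by (intro r_solve) auto
  then show ?thesis using assms by (simp add: inv_mult flexible_inv)
qed

lemma extra_middle:
  assumes "x \<in> carrier Q" "y \<in> carrier Q" "z \<in> carrier Q"
  shows "((x \<otimes> y) \<otimes> z) \<otimes> x = x \<otimes> (y \<otimes> (z \<otimes> x))"
  using l_r_inv_mult[of x y "z \<otimes> x"] assms by simp

text \<open>The left Moufang identity, with \<open>inv x \<otimes> z\<close> in place of its last
  variable. The autotopism \<open>l_r_inv_mult\<close> pulls \<open>x\<close> out on both sides, and
  \<open>extra_right\<close> simplifies what remains inside.\<close>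

lemma moufang:
  assumes "x \<in> carrier Q" "y \<in> carrier Q" "z \<in> carrier Q"
  shows "(x \<otimes> (y \<otimes> x)) \<otimes> (inv x \<otimes> z) = x \<otimes> (y \<otimes> z)"
proof -
  have "(x \<otimes> (y \<otimes> x)) \<otimes> (inv x \<otimes> z)
      = (x \<otimes> ((y \<otimes> x) \<otimes> ((inv x \<otimes> z) \<otimes> x))) \<otimes> inv x"
    using l_r_inv_mult[of x "y \<otimes> x" "(inv x \<otimes> z) \<otimes> x"] assms by simp
  also have "(y \<otimes> x) \<otimes> ((inv x \<otimes> z) \<otimes> x) = (y \<otimes> z) \<otimes> x"
    using extra_right[of x "inv x \<otimes> z" y] assms by simp
  finally show ?thesis using assms by (simp add: flexible[symmetric])
qed

text \<open>Of the two factors \<open>x\<close>, the first to act conjugates \<open>y\<close> past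
  itself by \<open>extra_left\<close>; the second is absorbed by \<open>moufang\<close>, which also
  cancels the \<open>x\<close> standing before \<open>z\<close>.\<close>

lemma square_mult_assoc:
  assumes "x \<in> carrier Q" "y \<in> carrier Q" "z \<in> carrier Q"
  shows "((x \<otimes> x) \<otimes> y) \<otimes> z = (x \<otimes> x) \<otimes> (y \<otimes> z)"
proof -
  let ?a = "x \<otimes> (y \<otimes> inv x)"
  have "(x \<otimes> x) \<otimes> (y \<otimes> z) = x \<otimes> (x \<otimes> (y \<otimes> z))" using assms l_alt by simp
  also have "x \<otimes> (y \<otimes> z) = ?a \<otimes> (x \<otimes> z)"
    using extra_left[of x "y \<otimes> inv x" z] assms by simp
  also have "x \<otimes> (?a \<otimes> (x \<otimes> z)) = (x \<otimes> (?a \<otimes> x)) \<otimes> (inv x \<otimes> (x \<otimes> z))"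
    using moufang[of x ?a "x \<otimes> z"] assms by simp
  also have "x \<otimes> (?a \<otimes> x) = (x \<otimes> x) \<otimes> y" using assms by (simp add: l_alt flexible)
  finally show ?thesis using assms by simp
qed

section \<open>The nucleus and its normality\<close>

definition nucleus :: "'a set" where
  "nucleus = {a \<in> carrier Q. \<forall>x \<in> carrier Q. \<forall>y \<in> carrier Q.
     (a \<otimes> x) \<otimes> y = a \<otimes> (x \<otimes> y) \<and> (x \<otimes> a) \<otimes> y = x \<otimes> (a \<otimes> y) \<and> (x \<otimes> y) \<otimes> a = x \<otimes> (y \<otimes> a)}"

lemma nucleus_closed [simp, intro]: "a \<in> nucleus \<Longrightarrow> a \<in> carrier Q"
  by (simp add: nucleus_def)

lemma nucleus_assoc:
  assumes "a \<in> nucleus" "x \<in> carrier Q" "y \<in> carrier Q"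
  shows "(a \<otimes> x) \<otimes> y = a \<otimes> (x \<otimes> y)" "(x \<otimes> a) \<otimes> y = x \<otimes> (a \<otimes> y)" "(x \<otimes> y) \<otimes> a = x \<otimes> (y \<otimes> a)"
  using assms unfolding nucleus_def by blast+

text \<open>With the inverse property, associating in the left position is enough: the condition
  passes to \<open>inv a\<close>, and inverting products exchanges left and right.\<close>

lemma nucleusI:
  assumes a: "a \<in> carrier Q"
    and l: "\<And>x y. x \<in> carrier Q \<Longrightarrow> y \<in> carrier Q \<Longrightarrow> (a \<otimes> x) \<otimes> y = a \<otimes> (x \<otimes> y)"
  shows "a \<in> nucleus"
proof -
  have l': "(inv a \<otimes> x) \<otimes> y = inv a \<otimes> (x \<otimes> y)" if "x \<in> carrier Q" "y \<in> carrier Q" for x y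
    using l[of "inv a \<otimes> x" y] that a by (intro l_solve) auto
  have r: "(x \<otimes> y) \<otimes> a = x \<otimes> (y \<otimes> a)" if "x \<in> carrier Q" "y \<in> carrier Q" for x y
    using arg_cong[OF l'[of "inv y" "inv x"], of "m_inv Q"] that a by (simp add: inv_mult)
  \<comment> \<open>Middle position: \<open>inv a \<otimes> inv x\<close> is the inverse of
    \<open>x \<otimes> a\<close>, and by \<open>l'\<close> it carries
    \<open>x \<otimes> (a \<otimes> y)\<close> to \<open>y\<close>.\<close>
  have m: "(x \<otimes> a) \<otimes> y = x \<otimes> (a \<otimes> y)" if "x \<in> carrier Q" "y \<in> carrier Q" for x y
  proof -
    have "(inv a \<otimes> inv x) \<otimes> (x \<otimes> (a \<otimes> y)) = y"
      using l'[of "inv x" "x \<otimes> (a \<otimes> y)"] that a by simp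
    then have "x \<otimes> (a \<otimes> y) = inv (inv a \<otimes> inv x) \<otimes> y" using that a by (simp add: l_solve)
    then show ?thesis using that a by (simp add: inv_mult)
  qed
  show ?thesis unfolding nucleus_def using a l r m by blast
qed

lemma square_nucleus: "x \<in> carrier Q \<Longrightarrow> x \<otimes> x \<in> nucleus"
  by (rule nucleusI) (auto simp: square_mult_assoc)

lemma one_nucleus [simp]: "\<one> \<in> nucleus"
  by (rule nucleusI) auto

lemma mult_nucleus [simp]: "a \<in> nucleus \<Longrightarrow> b \<in> nucleus \<Longrightarrow> a \<otimes> b \<in> nucleus"
  by (rule nucleusI) (auto simp: nucleus_assoc)

lemma inv_nucleus [simp]: "a \<in> nucleus \<Longrightarrow> inv a \<in> nucleus"
proof (rule nucleusI)
  fix x y assume a: "a \<in> nucleus" and "x \<in> carrier Q" "y \<in> carrier Q"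
  then show "(inv a \<otimes> x) \<otimes> y = inv a \<otimes> (x \<otimes> y)"
    using nucleus_assoc(1)[of a "inv a \<otimes> x" y] by (intro l_solve) auto
qed auto

lemma group_nucleus: "group (Q\<lparr>carrier := nucleus\<rparr>)"
proof (rule groupI)
  fix a assume "a \<in> carrier (Q\<lparr>carrier := nucleus\<rparr>)"
  then show "\<exists>b\<in>carrier (Q\<lparr>carrier := nucleus\<rparr>).
      b \<otimes>\<^bsub>Q\<lparr>carrier := nucleus\<rparr>\<^esub> a = \<one>\<^bsub>Q\<lparr>carrier := nucleus\<rparr>\<^esub>"
    by (intro bexI[of _ "inv a"]) auto
qed (auto simp: nucleus_assoc)

text \<open>In terms of left translations, $L_x L_n L_x^{-1} = L_{x n x^{-1}}$, and
  conjugating $L_n L_y = L_{n y}$ by $L_x$ shows that $x n x^{-1}$ is nuclear.\<close>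

lemma conj_nucleus:
  assumes n: "n \<in> nucleus" and x: "x \<in> carrier Q"
  shows "(x \<otimes> n) \<otimes> inv x \<in> nucleus"
proof (rule nucleusI)
  let ?c = "\<lambda>y. (x \<otimes> y) \<otimes> inv x"
  show "?c n \<in> carrier Q" using n x by auto
  have *: "?c n \<otimes> (?c y \<otimes> z) = ?c (n \<otimes> y) \<otimes> z" if "y \<in> carrier Q" "z \<in> carrier Q" for y z
  proof -
    let ?w = "inv x \<otimes> z"
    have "?c n \<otimes> (?c y \<otimes> (x \<otimes> ?w)) = x \<otimes> (n \<otimes> (y \<otimes> ?w))"
      using that n x l_conj_eq[of x n "y \<otimes> ?w"] l_conj_eq[of x y ?w] by auto
    also have "\<dots> = ?c (n \<otimes> y) \<otimes> (x \<otimes> ?w)"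
      using that n x l_conj_eq[of x "n \<otimes> y" ?w] by (simp add: nucleus_assoc nucleus_closed)
    finally show ?thesis using that x by simp
  qed
  fix u z assume uz: "u \<in> carrier Q" "z \<in> carrier Q"
  \<comment> \<open>Conjugation by \<open>x\<close> is onto: this \<open>y\<close> is the preimage
    of \<open>u\<close>, so \<open>*\<close> applies to an arbitrary middle factor.\<close>
  define y where "y = inv x \<otimes> (u \<otimes> x)"
  have y: "y \<in> carrier Q" "?c y = u" using uz x by (auto simp: y_def)
  have "?c n \<otimes> u = ?c (n \<otimes> y)"
    using *[of y \<one>] y n x uz nucleus_closed[OF n] by simp
  then show "(?c n \<otimes> u) \<otimes> z = ?c n \<otimes> (u \<otimes> z)" using *[of y z] y uz by simp
qed

text \<open>Normality in its working form: a nuclear factor passes \<open>x\<close> after being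
  replaced by a conjugate.\<close>

lemma nucleus_commute_left:
  assumes "n \<in> nucleus" "x \<in> carrier Q"
  obtains m where "m \<in> nucleus" "x \<otimes> n = m \<otimes> x"
  using conj_nucleus[OF assms] assms by (intro that[of "(x \<otimes> n) \<otimes> inv x"]) auto

lemma nucleus_commute_right:
  assumes "n \<in> nucleus" "x \<in> carrier Q"
  obtains m where "m \<in> nucleus" "n \<otimes> x = x \<otimes> m"
proof (rule that)
  show "(inv x \<otimes> n) \<otimes> inv (inv x) \<in> nucleus" using assms by (intro conj_nucleus) auto
  then show "n \<otimes> x = x \<otimes> ((inv x \<otimes> n) \<otimes> inv (inv x))"
    using assms by (simp add: nucleus_assoc nucleus_closed)
qed

section \<open>The quotient by the nucleus\<close>

text \<open>The coset and quotient constants make sense for any multiplication, but their group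
  lemmas assume a group; the loop versions are proved below.\<close>

abbreviation coset :: "'a \<Rightarrow> 'a set" where "coset x \<equiv> nucleus #> x"

lemma mem_coset: "u \<in> coset x \<longleftrightarrow> (\<exists>n \<in> nucleus. u = n \<otimes> x)"
  by (auto simp: r_coset_def)

lemma coset_nucleus_mult:
  assumes n: "n \<in> nucleus" and x: "x \<in> carrier Q"
  shows "coset (n \<otimes> x) = coset x"
proof (intro Set.set_eqI iffI)
  fix u assume "u \<in> coset (n \<otimes> x)"
  then obtain k where "k \<in> nucleus" "u = k \<otimes> (n \<otimes> x)" by (auto simp: mem_coset)
  then show "u \<in> coset x" using n x by (auto simp: mem_coset nucleus_assoc intro!: bexI[of _ "k \<otimes> n"])
next
  fix u assume "u \<in> coset x"
  then obtain k where "k \<in> nucleus" "u = k \<otimes> x" by (auto simp: mem_coset)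
  then show "u \<in> coset (n \<otimes> x)" using n x
    by (auto simp: mem_coset nucleus_assoc[symmetric] intro!: bexI[of _ "k \<otimes> inv n"])
qed

lemma coset_mult_nucleus:
  assumes "n \<in> nucleus" "x \<in> carrier Q"
  shows "coset (x \<otimes> n) = coset x"
  using assms by (metis nucleus_commute_left coset_nucleus_mult)

lemma coset_self: "x \<in> carrier Q \<Longrightarrow> x \<in> coset x"
  by (auto simp: mem_coset intro!: bexI[of _ \<one>])

lemma coset_member:
  assumes "u \<in> coset x" "x \<in> carrier Q"
  shows "coset u = coset x"
  using assms coset_nucleus_mult[of _ x] unfolding mem_coset by blast

lemma coset_eqD:
  assumes "x \<in> carrier Q" "coset x = coset y"
  obtains n where "n \<in> nucleus" "x = n \<otimes> y"
  using coset_self[OF assms(1)] assms(2) that by (auto simp: mem_coset)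

lemma coset_eqD_right:
  assumes "x \<in> carrier Q" "y \<in> carrier Q" "coset x = coset y"
  obtains n where "n \<in> nucleus" "x = y \<otimes> n"
  using assms by (metis coset_eqD nucleus_commute_right)

text \<open>Normality allows \<open>x\<close> to differ from \<open>x'\<close> by a factor on the
  left and \<open>y\<close> from \<open>y'\<close> by one on the right, so both end up at the
  outside of the product.\<close>

lemma coset_mult_cong:
  assumes "x \<in> carrier Q" "y \<in> carrier Q" "x' \<in> carrier Q" "y' \<in> carrier Q"
    and "coset x = coset x'" "coset y = coset y'"
  shows "coset (x \<otimes> y) = coset (x' \<otimes> y')"
proof -
  obtain n where n: "n \<in> nucleus" "x = n \<otimes> x'" using assms coset_eqD by metis
  obtain m where m: "m \<in> nucleus" "y = y' \<otimes> m" using assms coset_eqD_right by metis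
  have "x \<otimes> y = n \<otimes> ((x' \<otimes> y') \<otimes> m)" using n m assms by (simp add: nucleus_assoc nucleus_closed)
  then show ?thesis using n m assms
    by (simp add: coset_nucleus_mult coset_mult_nucleus nucleus_closed)
qed

text \<open>\<open>inv x\<close> is \<open>x\<close> multiplied by the nuclear square of
  \<open>inv x\<close>.\<close>

lemma coset_inv:
  assumes x: "x \<in> carrier Q"
  shows "coset (inv x) = coset x"
proof -
  have "inv x = (inv x \<otimes> inv x) \<otimes> x" using x by (simp add: l_alt)
  then show ?thesis using coset_nucleus_mult[OF square_nucleus[of "inv x"] x] x by simp
qed

text \<open>Inversion reverses products but fixes every coset; the argument does not rely on
  associativity of the quotient.\<close>

lemma coset_commute:
  assumes xy: "x \<in> carrier Q" "y \<in> carrier Q"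
  shows "coset (x \<otimes> y) = coset (y \<otimes> x)"
proof -
  have "coset (x \<otimes> y) = coset (inv y \<otimes> inv x)"
    using xy coset_inv[of "x \<otimes> y"] by (simp add: inv_mult)
  also have "\<dots> = coset (y \<otimes> x)" using xy by (intro coset_mult_cong coset_inv) auto
  finally show ?thesis .
qed

text \<open>Since cosets commute, conjugation acts trivially on them, and the left conjugacy
  law becomes $x (y z) = y (x z)$ modulo the nucleus.\<close>

lemma coset_assoc:
  assumes xyz: "x \<in> carrier Q" "y \<in> carrier Q" "z \<in> carrier Q"
  shows "coset ((x \<otimes> y) \<otimes> z) = coset (x \<otimes> (y \<otimes> z))"
proof -
  have *: "coset (a \<otimes> (b \<otimes> c)) = coset (b \<otimes> (a \<otimes> c))"
    if abc: "a \<in> carrier Q" "b \<in> carrier Q" "c \<in> carrier Q" for a b c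
  proof -
    have "coset ((a \<otimes> b) \<otimes> inv a) = coset ((b \<otimes> a) \<otimes> inv a)"
      using abc by (intro coset_mult_cong coset_commute) auto
    then have "coset ((a \<otimes> b) \<otimes> inv a) = coset b" using abc by simp
    then have "coset (((a \<otimes> b) \<otimes> inv a) \<otimes> (a \<otimes> c)) = coset (b \<otimes> (a \<otimes> c))"
      using abc by (intro coset_mult_cong) auto
    then show ?thesis using l_conj_eq[OF abc] by simp
  qed
  have "coset (x \<otimes> (y \<otimes> z)) = coset (x \<otimes> (z \<otimes> y))"
    using xyz by (intro coset_mult_cong coset_commute) auto
  also have "\<dots> = coset (z \<otimes> (x \<otimes> y))" using xyz * by simp
  also have "\<dots> = coset ((x \<otimes> y) \<otimes> z)" using xyz by (intro coset_commute) auto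
  finally show ?thesis by simp
qed

text \<open>Translates the setwise product in \<open>Mod\<close> into multiplication of
  representatives.\<close>

lemma set_mult_coset:
  assumes "x \<in> carrier Q" "y \<in> carrier Q"
  shows "coset x <#> coset y = coset (x \<otimes> y)"
proof (intro Set.set_eqI iffI)
  fix u assume "u \<in> coset x <#> coset y"
  then obtain n m where nm: "n \<in> nucleus" "m \<in> nucleus" "u = (n \<otimes> x) \<otimes> (m \<otimes> y)"
    by (auto simp: set_mult_def mem_coset)
  then obtain k where k: "k \<in> nucleus" "x \<otimes> m = k \<otimes> x" using assms nucleus_commute_left by metis
  have "u = n \<otimes> ((x \<otimes> m) \<otimes> y)" using nm assms by (simp add: nucleus_assoc nucleus_closed)
  also have "\<dots> = (n \<otimes> k) \<otimes> (x \<otimes> y)" using nm k assms by (simp add: nucleus_assoc nucleus_closed)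
  finally show "u \<in> coset (x \<otimes> y)" using nm k by (auto simp: mem_coset)
next
  fix u assume "u \<in> coset (x \<otimes> y)"
  then obtain n where "n \<in> nucleus" "u = n \<otimes> (x \<otimes> y)" by (auto simp: mem_coset)
  then have "u = (n \<otimes> x) \<otimes> y" "n \<otimes> x \<in> coset x"
    using assms by (auto simp: nucleus_assoc nucleus_closed mem_coset)
  then show "u \<in> coset x <#> coset y"
    using coset_self[OF assms(2)] by (auto simp: set_mult_def)
qed

lemma coset_one: "coset \<one> = nucleus"
proof (intro Set.set_eqI iffI)
  fix u assume "u \<in> nucleus"
  then show "u \<in> coset \<one>" by (auto simp: mem_coset intro!: bexI[of _ u])
qed (auto simp: mem_coset)

lemma coset_square: "x \<in> carrier Q \<Longrightarrow> coset (x \<otimes> x) = nucleus"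
  using coset_nucleus_mult[of "x \<otimes> x" \<one>] square_nucleus coset_one by simp

lemma carrier_Mod: "carrier (Q Mod nucleus) = coset ` carrier Q"
  by (auto simp: FactGroup_def RCOSETS_def)

lemma group_Mod_nucleus: "group (Q Mod nucleus)"
proof (rule groupI)
  show "\<one>\<^bsub>Q Mod nucleus\<^esub> \<in> carrier (Q Mod nucleus)"
    unfolding carrier_Mod using imageI[OF one_closed, of coset] by (simp add: FactGroup_def coset_one)
  fix A assume "A \<in> carrier (Q Mod nucleus)"
  then obtain x where x: "x \<in> carrier Q" "A = coset x" by (auto simp: carrier_Mod)
  then show "\<one>\<^bsub>Q Mod nucleus\<^esub> \<otimes>\<^bsub>Q Mod nucleus\<^esub> A = A"
    using set_mult_coset[of \<one> x] by (simp add: FactGroup_def coset_one)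
  show "\<exists>B\<in>carrier (Q Mod nucleus). B \<otimes>\<^bsub>Q Mod nucleus\<^esub> A = \<one>\<^bsub>Q Mod nucleus\<^esub>"
  proof
    show "A \<otimes>\<^bsub>Q Mod nucleus\<^esub> A = \<one>\<^bsub>Q Mod nucleus\<^esub>"
      using x by (simp add: FactGroup_def set_mult_coset coset_square)
  qed fact
  fix B assume "B \<in> carrier (Q Mod nucleus)"
  then obtain y where y: "y \<in> carrier Q" "B = coset y" by (auto simp: carrier_Mod)
  then show "A \<otimes>\<^bsub>Q Mod nucleus\<^esub> B \<in> carrier (Q Mod nucleus)"
    unfolding carrier_Mod using x set_mult_coset by (auto simp: FactGroup_def)
  fix C assume "C \<in> carrier (Q Mod nucleus)"
  then obtain z where z: "z \<in> carrier Q" "C = coset z" by (auto simp: carrier_Mod)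
  show "A \<otimes>\<^bsub>Q Mod nucleus\<^esub> B \<otimes>\<^bsub>Q Mod nucleus\<^esub> C = A \<otimes>\<^bsub>Q Mod nucleus\<^esub> (B \<otimes>\<^bsub>Q Mod nucleus\<^esub> C)"
    using x y z by (simp add: FactGroup_def set_mult_coset coset_assoc)
qed

lemma Mod_nucleus_square:
  assumes "A \<in> carrier (Q Mod nucleus)"
  shows "A \<otimes>\<^bsub>Q Mod nucleus\<^esub> A = \<one>\<^bsub>Q Mod nucleus\<^esub>"
proof -
  obtain x where "x \<in> carrier Q" "A = coset x" using assms by (auto simp: carrier_Mod)
  then show ?thesis by (simp add: FactGroup_def set_mult_coset coset_square)
qed

text \<open>Lagrange's count carried over to the loop: cosets partition \<open>Q\<close>, and right
  translations are injective by cancellation.\<close>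

lemma card_nucleus_Mod:
  assumes fin: "finite (carrier Q)"
  shows "card nucleus * order (Q Mod nucleus) = card (carrier Q)"
proof -
  have un: "\<Union> (coset ` carrier Q) = carrier Q"
    using coset_self by (auto simp: mem_coset nucleus_closed)
  have "card nucleus * card (coset ` carrier Q) = card (\<Union> (coset ` carrier Q))"
  proof (rule card_partition)
    fix A assume "A \<in> coset ` carrier Q"
    then obtain x where x: "x \<in> carrier Q" "A = coset x" by auto
    have "A = (\<lambda>n. n \<otimes> x) ` nucleus" using x by (auto simp: mem_coset)
    moreover have "inj_on (\<lambda>n. n \<otimes> x) nucleus" using x by (auto intro!: inj_onI simp: r_cancel)
    ultimately show "card A = card nucleus" by (simp add: card_image)
  next
    fix A B assume "A \<in> coset ` carrier Q" "B \<in> coset ` carrier Q" "A \<noteq> B"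
    then obtain x y where xy: "x \<in> carrier Q" "A = coset x" "y \<in> carrier Q" "B = coset y" by auto
    have "A = B" if u: "u \<in> A" "u \<in> B" for u
    proof -
      have "coset u = coset x" "coset u = coset y"
        using u xy(2,4) coset_member[OF _ xy(1)] coset_member[OF _ xy(3)] by blast+
      then show ?thesis using xy(2,4) by simp
    qed
    with \<open>A \<noteq> B\<close> show "A \<inter> B = {}" by blast
  qed (use fin un in auto)
  then show ?thesis unfolding un order_def carrier_Mod .
qed

section \<open>Associators: invariance modulo the nucleus, symmetry, order two\<close>

definition associator :: "'a \<Rightarrow> 'a \<Rightarrow> 'a \<Rightarrow> 'a" where
  "associator x y z = inv (x \<otimes> (y \<otimes> z)) \<otimes> ((x \<otimes> y) \<otimes> z)"

lemma associator_eq: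
  assumes "x \<in> carrier Q" "y \<in> carrier Q" "z \<in> carrier Q"
  shows "(x \<otimes> y) \<otimes> z = (x \<otimes> (y \<otimes> z)) \<otimes> associator x y z"
  using assms by (simp add: associator_def)

lemma associatorI:
  assumes "x \<in> carrier Q" "y \<in> carrier Q" "z \<in> carrier Q" "a \<in> carrier Q"
    and "(x \<otimes> y) \<otimes> z = (x \<otimes> (y \<otimes> z)) \<otimes> a"
  shows "associator x y z = a"
  using assms by (simp add: associator_def)

text \<open>The quotient is associative, so both bracketings lie in the same coset.\<close>

lemma associator_nucleus [simp]:
  assumes "x \<in> carrier Q" "y \<in> carrier Q" "z \<in> carrier Q"
  shows "associator x y z \<in> nucleus"
proof -
  obtain n where n: "n \<in> nucleus" "(x \<otimes> y) \<otimes> z = (x \<otimes> (y \<otimes> z)) \<otimes> n"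
    using coset_eqD_right[OF _ _ coset_assoc[OF assms]] assms by auto
  then have "associator x y z = n" using assms by (intro associatorI) auto
  with n show ?thesis by simp
qed

lemma associator_closed [simp]:
  assumes "x \<in> carrier Q" "y \<in> carrier Q" "z \<in> carrier Q"
  shows "associator x y z \<in> carrier Q"
  using associator_nucleus[OF assms] by (rule nucleus_closed)

lemma associator_nucleus_left:
  assumes "n \<in> nucleus" "x \<in> carrier Q" "y \<in> carrier Q" "z \<in> carrier Q"
  shows "associator (n \<otimes> x) y z = associator x y z"
proof (rule associatorI)
  show "((n \<otimes> x) \<otimes> y) \<otimes> z = ((n \<otimes> x) \<otimes> (y \<otimes> z)) \<otimes> associator x y z"
    using assms associator_eq[of x y z] by (simp add: nucleus_assoc(1) nucleus_closed)
qed (use assms in \<open>auto simp: nucleus_closed\<close>)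

text \<open>Combined with normality, this moves a nuclear factor of a later argument leftwards to
  the front, where \<open>associator_nucleus_left\<close> discards it.\<close>

lemma associator_nucleus_shift:
  assumes "n \<in> nucleus" "x \<in> carrier Q" "y \<in> carrier Q" "z \<in> carrier Q"
  shows "associator (x \<otimes> n) y z = associator x (n \<otimes> y) z"
    and "associator x (y \<otimes> n) z = associator x y (n \<otimes> z)"
  using assms
  by (simp_all add: associator_def nucleus_assoc(1,2) nucleus_assoc(3)[symmetric] nucleus_closed)

lemma associator_nucleus_middle:
  assumes "n \<in> nucleus" "x \<in> carrier Q" "y \<in> carrier Q" "z \<in> carrier Q"
  shows "associator x (n \<otimes> y) z = associator x y z"
proof -
  obtain m where "m \<in> nucleus" "x \<otimes> n = m \<otimes> x" using assms nucleus_commute_left by metis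
  then show ?thesis using assms by (metis associator_nucleus_shift(1) associator_nucleus_left)
qed

lemma associator_nucleus_right:
  assumes "n \<in> nucleus" "x \<in> carrier Q" "y \<in> carrier Q" "z \<in> carrier Q"
  shows "associator x y (n \<otimes> z) = associator x y z"
proof -
  obtain m where "m \<in> nucleus" "y \<otimes> n = m \<otimes> y" using assms nucleus_commute_left by metis
  then show ?thesis using assms by (metis associator_nucleus_shift(2) associator_nucleus_middle)
qed

text \<open>Makes the associator a function on the quotient, so arguments may be commuted or
  inverted using \<open>coset_commute\<close> and \<open>coset_inv\<close>.\<close>

lemma associator_cong:
  assumes "x \<in> carrier Q" "y \<in> carrier Q" "z \<in> carrier Q"
    and "x' \<in> carrier Q" "y' \<in> carrier Q" "z' \<in> carrier Q"
    and "coset x = coset x'" "coset y = coset y'" "coset z = coset z'"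
  shows "associator x y z = associator x' y' z'"
proof -
  obtain k where k: "k \<in> nucleus" "x = k \<otimes> x'" using assms coset_eqD by metis
  obtain m where m: "m \<in> nucleus" "y = m \<otimes> y'" using assms coset_eqD by metis
  obtain n where n: "n \<in> nucleus" "z = n \<otimes> z'" using assms coset_eqD by metis
  have "associator x y z = associator x' y z"
    unfolding k(2) using k assms(2-4) by (intro associator_nucleus_left)
  also have "\<dots> = associator x' y' z"
    unfolding m(2) using m assms(3-5) by (intro associator_nucleus_middle)
  also have "\<dots> = associator x' y' z'"
    unfolding n(2) using n assms(4-6) by (intro associator_nucleus_right)
  finally show ?thesis .
qed

text \<open>Write \<open>u = x \<otimes> y\<close>. By \<open>extra_left\<close> and flexibility,
  the two bracketings of \<open>u, x, z\<close> are those of \<open>x, y \<otimes> x, z\<close>; and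
  \<open>y \<otimes> x\<close> lies in the coset of \<open>u\<close>. The right swap is the mirror
  image.\<close>

lemma associator_swap_left:
  assumes u: "u \<in> carrier Q" and x: "x \<in> carrier Q" and z: "z \<in> carrier Q"
  shows "associator u x z = associator x u z"
proof -
  define y where "y = inv x \<otimes> u"
  have y: "y \<in> carrier Q" "x \<otimes> y = u" using u x by (auto simp: y_def)
  have "associator u x z = associator x (y \<otimes> x) z"
  proof (rule associatorI)
    have "u \<otimes> (x \<otimes> z) = x \<otimes> ((y \<otimes> x) \<otimes> z)" using extra_left[of x y z] x y z by simp
    moreover have "u \<otimes> x = x \<otimes> (y \<otimes> x)" using flexible[of x y] x y by simp
    ultimately show "(u \<otimes> x) \<otimes> z = (u \<otimes> (x \<otimes> z)) \<otimes> associator x (y \<otimes> x) z"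
      using associator_eq[of x "y \<otimes> x" z] x y z by simp
  qed (use u x y z in auto)
  also have "\<dots> = associator x u z"
    using coset_commute[of x y] u x y z by (intro associator_cong) auto
  finally show ?thesis .
qed

lemma associator_swap_right:
  assumes z: "z \<in> carrier Q" and x: "x \<in> carrier Q" and u: "u \<in> carrier Q"
  shows "associator z x u = associator z u x"
proof -
  define y where "y = u \<otimes> inv x"
  have y: "y \<in> carrier Q" "y \<otimes> x = u" using u x by (auto simp: y_def)
  have "associator z x u = associator z (x \<otimes> y) x"
  proof (rule associatorI)
    have "(z \<otimes> x) \<otimes> u = (z \<otimes> (x \<otimes> y)) \<otimes> x" using extra_right[of x y z] x y z by simp
    moreover have "x \<otimes> u = (x \<otimes> y) \<otimes> x" using flexible[of x y] x y by simp
    ultimately show "(z \<otimes> x) \<otimes> u = (z \<otimes> (x \<otimes> u)) \<otimes> associator z (x \<otimes> y) x"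
      using associator_eq[of z "x \<otimes> y" x] x y z by simp
  qed (use u x y z in auto)
  also have "\<dots> = associator z u x"
    using coset_commute[of x y] u x y z by (intro associator_cong) auto
  finally show ?thesis .
qed

text \<open>Equivalently, \<open>x\<close> conjugates the associator to its inverse. Rebracket
  \<open>x, y, z\<close> on one side of \<open>extra_middle\<close> and \<open>y, z, x\<close> on
  the other: by symmetry both give the same associator, once before and once after
  \<open>x\<close>.\<close>

lemma associator_conj:
  assumes x: "x \<in> carrier Q" and y: "y \<in> carrier Q" and z: "z \<in> carrier Q"
  shows "(associator x y z \<otimes> x) \<otimes> associator x y z = x"
proof -
  let ?a = "associator x y z"
  have a: "?a \<in> nucleus" using x y z by simp
  have eq: "associator y z x = ?a"
    using x y z by (metis associator_swap_left associator_swap_right)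
  have "x \<otimes> (y \<otimes> (z \<otimes> x)) = (x \<otimes> (y \<otimes> z)) \<otimes> (?a \<otimes> x)"
    using extra_middle[OF x y z] associator_eq[OF x y z] nucleus_assoc(2)[OF a] x y z by simp
  then have "((x \<otimes> (y \<otimes> z)) \<otimes> (?a \<otimes> x)) \<otimes> ?a = x \<otimes> ((y \<otimes> (z \<otimes> x)) \<otimes> ?a)"
    using nucleus_assoc(3)[OF a, of x "y \<otimes> (z \<otimes> x)"] x y z by simp
  also have "\<dots> = (x \<otimes> (y \<otimes> z)) \<otimes> x"
    using associator_eq[OF y z x] eq flexible[of x "y \<otimes> z"] x y z by simp
  finally have "(x \<otimes> (y \<otimes> z)) \<otimes> ((?a \<otimes> x) \<otimes> ?a) = (x \<otimes> (y \<otimes> z)) \<otimes> x"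
    using nucleus_assoc(3)[OF a] x y z by simp
  then show ?thesis using l_cancel x y z by simp
qed

text \<open>Replace the first \<open>x\<close> by \<open>inv x\<close>, which lies in the same
  coset. Then \<open>inv x\<close> cancels against \<open>x \<otimes> y\<close>, and the associator
  of \<open>x, y, z\<close> appears on the opposite side of the equation.\<close>

lemma associator_product:
  assumes x: "x \<in> carrier Q" and y: "y \<in> carrier Q" and z: "z \<in> carrier Q"
  shows "associator x (x \<otimes> y) z = inv (associator x y z)"
proof -
  let ?a = "associator x y z"
  have a: "?a \<in> nucleus" using x y z by simp
  have "associator x (x \<otimes> y) z = associator (inv x) (x \<otimes> y) z"
    using x y z by (intro associator_cong) (auto simp: coset_inv)
  also have "\<dots> = inv ?a"
  proof (rule associatorI)
    have "inv x \<otimes> ((x \<otimes> y) \<otimes> z) = (y \<otimes> z) \<otimes> ?a"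
      using associator_eq[OF x y z] nucleus_assoc(3)[OF a, of "inv x" "x \<otimes> (y \<otimes> z)"] x y z by simp
    then show "(inv x \<otimes> (x \<otimes> y)) \<otimes> z = (inv x \<otimes> ((x \<otimes> y) \<otimes> z)) \<otimes> inv ?a"
      using x y z by simp
  qed (use x y z in auto)
  finally show ?thesis .
qed

text \<open>By symmetry, $x$ and $y$ each conjugate the associator $a$ of $x, y, z$ to its inverse,
  so $x y$ centralizes $a$. But $a^{-1}$ is the associator of $x, x y, z$, so $x y$ inverts it too.\<close>

lemma associator_square:
  assumes x: "x \<in> carrier Q" and y: "y \<in> carrier Q" and z: "z \<in> carrier Q"
  shows "associator x y z \<otimes> associator x y z = \<one>"
proof -
  let ?a = "associator x y z"
  have a: "?a \<in> nucleus" "inv ?a \<in> nucleus" "?a \<in> carrier Q" using x y z by simp_all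
  have ax: "?a \<otimes> x = x \<otimes> inv ?a"
    using associator_conj[OF x y z] x y z by (intro r_solve) auto
  have "(?a \<otimes> y) \<otimes> ?a = y"
    using associator_conj[OF y x z] associator_swap_left[OF x y z] by simp
  then have ay: "inv ?a \<otimes> y = y \<otimes> ?a"
    using a y nucleus_assoc(1)[OF a(1), of y ?a] l_solve[of ?a "y \<otimes> ?a" y] by simp
  have "(inv ?a \<otimes> (x \<otimes> y)) \<otimes> inv ?a = x \<otimes> y"
    using associator_conj[of "x \<otimes> y" x z] associator_product[OF x y z]
      associator_swap_left[of x "x \<otimes> y" z] x y z by simp
  then have axy: "inv ?a \<otimes> (x \<otimes> y) = (x \<otimes> y) \<otimes> ?a"
    using r_solve[of "inv ?a" "inv ?a \<otimes> (x \<otimes> y)" "x \<otimes> y"] a x y by simp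
  have "?a \<otimes> (x \<otimes> y) = (?a \<otimes> x) \<otimes> y" using nucleus_assoc(1)[OF a(1) x y] by simp
  also have "\<dots> = x \<otimes> (inv ?a \<otimes> y)" using ax nucleus_assoc(2)[OF a(2) x y] by simp
  also have "\<dots> = inv ?a \<otimes> (x \<otimes> y)" using ay axy nucleus_assoc(3)[OF a(1) x y] by simp
  finally have "?a = inv ?a" using r_cancel a x y by simp
  then show ?thesis using r_inv[OF a(3)] by simp
qed

section \<open>Lower bounds from a nonassociating triple\<close>

text \<open>The nontrivial associator has order exactly two in the group \<open>nucleus\<close>, so
  Lagrange's theorem applies.\<close>

lemma even_card_nucleus:
  assumes xyz: "x \<in> carrier Q" "y \<in> carrier Q" "z \<in> carrier Q" "(x \<otimes> y) \<otimes> z \<noteq> x \<otimes> (y \<otimes> z)"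
  shows "even (card nucleus)"
proof -
  let ?N = "Q\<lparr>carrier := nucleus\<rparr>" and ?a = "associator x y z"
  interpret N: group ?N by (rule group_nucleus)
  have a: "?a \<in> carrier ?N" using xyz by simp
  have "?a \<noteq> \<one>" using associator_eq[of x y z] xyz by auto
  moreover have "?a [^]\<^bsub>?N\<^esub> (2::nat) = \<one>"
    using associator_square[of x y z] xyz N.nat_pow_Suc[of ?a 1] a by (simp add: numeral_2_eq_2)
  ultimately have "N.ord ?a = 2"
    using N.pow_eq_id[OF a, of 2] N.ord_eq_1[OF a] two_is_prime_nat
    by (auto simp: prime_nat_iff)
  then show ?thesis using N.ord_dvd_group_order[OF a] by (simp add: order_def)
qed

text \<open>If $x, y, z$ do not associate, then $1, x, y, x y, z$ lie in different cosets, since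
  otherwise two elements would generate all three modulo the nucleus.\<close>

lemma order_Mod_nucleus_gt_4:
  assumes fin: "finite (carrier Q)"
    and x: "x \<in> carrier Q" and y: "y \<in> carrier Q" and z: "z \<in> carrier Q"
    and ne: "(x \<otimes> y) \<otimes> z \<noteq> x \<otimes> (y \<otimes> z)"
  shows "order (Q Mod nucleus) > 4"
proof -
  have A: "associator x y z \<noteq> \<one>" using associator_eq[OF x y z] ne x y z by auto
  have assoc: "associator x' y' z' \<noteq> \<one>"
    if "x' \<in> carrier Q" "y' \<in> carrier Q" "z' \<in> carrier Q"
      "coset x' = coset x" "coset y' = coset y" "coset z' = coset z" for x' y' z'
    using associator_cong[OF that(1-3) x y z that(4-6)] A by simp
  \<comment> \<open>Triples inside a two-generated subgroup associate; these are the degenerate ones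
    that coinciding cosets would produce.\<close>
  have one: "associator \<one> u v = \<one>" "associator u \<one> v = \<one>" "associator u v \<one> = \<one>"
    and alt: "associator u u v = \<one>" "associator v u u = \<one>" "associator u v u = \<one>"
    and xyxy: "associator u v (u \<otimes> v) = \<one>"
    if "u \<in> carrier Q" "v \<in> carrier Q" for u v
    using that by (auto intro!: associatorI simp: l_alt r_alt flexible square_product)
  \<comment> \<open>Were two of these cosets equal, exchanging representatives would turn the triple
    into a degenerate one without changing its associator.\<close>
  have d: "coset \<one> \<noteq> coset x" "coset \<one> \<noteq> coset y" "coset \<one> \<noteq> coset z"
    "coset x \<noteq> coset y" "coset x \<noteq> coset z" "coset y \<noteq> coset z" "coset (x \<otimes> y) \<noteq> coset z"
    using assoc[of \<one> y z] assoc[of x \<one> z] assoc[of x y \<one>] assoc[of x x z] assoc[of x y x]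
      assoc[of x y y] assoc[of x y "x \<otimes> y"] one alt xyxy x y z by auto
  \<comment> \<open>The remaining coincidences reduce to \<open>d\<close> by cancelling
    \<open>x\<close> or \<open>y\<close>; here \<open>y\<close> would lie in the coset of
    \<open>inv x\<close>, which is that of \<open>x\<close>.\<close>
  have "coset (x \<otimes> y) \<noteq> coset \<one>"
  proof
    assume "coset (x \<otimes> y) = coset \<one>"
    then have "coset (inv x \<otimes> (x \<otimes> y)) = coset (inv x \<otimes> \<one>)" using x y by (intro coset_mult_cong) auto
    then show False using d(4) x y by (simp add: coset_inv)
  qed
  moreover have "coset (x \<otimes> y) \<noteq> coset x"
  proof
    assume "coset (x \<otimes> y) = coset x"
    then have "coset (inv x \<otimes> (x \<otimes> y)) = coset (inv x \<otimes> x)" using x y by (intro coset_mult_cong) auto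
    then show False using d(2) x y by simp
  qed
  moreover have "coset (x \<otimes> y) \<noteq> coset y"
  proof
    assume "coset (x \<otimes> y) = coset y"
    then have "coset ((x \<otimes> y) \<otimes> inv y) = coset (y \<otimes> inv y)" using x y by (intro coset_mult_cong) auto
    then show False using d(1) x y by simp
  qed
  ultimately have "card {coset \<one>, coset x, coset y, coset (x \<otimes> y), coset z} = 5"
    using d by simp
  moreover have "card {coset \<one>, coset x, coset y, coset (x \<otimes> y), coset z} \<le> card (coset ` carrier Q)"
    using fin x y z by (intro card_mono) auto
  ultimately show ?thesis unfolding order_def carrier_Mod by simp
qed

end

section \<open>Finite groups of exponent two, and the final count\<close>

text \<open>For a prime \<open>p\<close> dividing the order, a nontrivial element of a subgroup of
  order \<open>p\<close> has order dividing both \<open>p\<close> and 2, so \<open>p = 2\<close> and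
  the odd part of the order is 1.\<close>

lemma (in group) order_power_of_two:
  assumes fin: "finite (carrier G)" and sq: "\<And>x. x \<in> carrier G \<Longrightarrow> x \<otimes> x = \<one>"
  obtains k where "order G = 2 ^ k"
proof -
  have pos: "order G \<noteq> 0" using fin order_gt_0_iff_finite by simp
  have two: "p = 2" if p: "prime p" "p dvd order G" for p
  proof -
    \<comment> \<open>The exponent 1 makes Sylow's theorem serve as Cauchy's theorem.\<close>
    obtain m where "order G = p ^ 1 * m" using p by auto
    then obtain H where H: "subgroup H G" "card H = p ^ 1" using sylow_thm[OF p(1) is_group] fin by blast
    have "\<not> H \<subseteq> {\<one>}" using H p card_mono[of "{\<one>}" H] prime_gt_1_nat[of p] by auto
    then obtain x where x: "x \<in> H" "x \<noteq> \<one>" by blast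
    then have xG: "x \<in> carrier G" using H(1) subgroup.mem_carrier by metis
    interpret H: group "G\<lparr>carrier := H\<rparr>" using H(1) subgroup.subgroup_is_group is_group by blast
    have "x [^] p = \<one>"
      using H.pow_order_eq_1[of x] x H by (simp add: order_def flip: nat_pow_consistent)
    then have "ord x dvd p" using pow_eq_id xG by simp
    moreover have "ord x dvd 2" using pow_eq_id[OF xG, of 2] sq xG by (simp add: numeral_2_eq_2)
    moreover have "ord x \<noteq> 1" using ord_eq_1 x xG by simp
    ultimately show "p = 2" using p(1) two_is_prime_nat by (metis prime_nat_iff)
  qed
  obtain m where km: "order G = 2 ^ multiplicity 2 (order G) * m" "\<not> 2 dvd m"
    by (rule multiplicity_decompose'[OF pos, of 2]) auto
  have "m = 1"
  proof (rule ccontr)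
    assume "m \<noteq> 1"
    then obtain p where "prime p" "p dvd m" using prime_factor_nat by blast
    then show False using two[of p] km dvd_mult by metis
  qed
  then show thesis using km that by (metis mult_1_right)
qed

theorem corollary4p14:
  fixes Q :: "('a, 'b) monoid_scheme" (structure)
  assumes "extra_loop Q"
    and "finite (carrier Q)"
    and "\<not> (\<forall>x \<in> carrier Q. \<forall>y \<in> carrier Q. \<forall>z \<in> carrier Q. (x \<otimes> y) \<otimes> z = x \<otimes> (y \<otimes> z))"
  shows "16 dvd card (carrier Q)"
proof -
  interpret extra_loop Q by fact
  obtain x y z where xyz: "x \<in> carrier Q" "y \<in> carrier Q" "z \<in> carrier Q"
    "(x \<otimes> y) \<otimes> z \<noteq> x \<otimes> (y \<otimes> z)"
    using assms(3) by blast
  interpret M: group "Q Mod nucleus" by (rule group_Mod_nucleus)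
  have "finite (carrier (Q Mod nucleus))" using assms(2) by (simp add: carrier_Mod)
  then obtain k where k: "order (Q Mod nucleus) = 2 ^ k"
    using M.order_power_of_two Mod_nucleus_square by blast
  \<comment> \<open>A power of two exceeding 4 is divisible by 8; the even order of the nucleus
    supplies the last factor 2.\<close>
  then have "(2::nat) ^ 2 < 2 ^ k" using order_Mod_nucleus_gt_4[OF assms(2) xyz] by simp
  then have "k \<ge> 3" using power_less_imp_less_exp[of "2::nat" 2 k] by simp
  then have "8 dvd order (Q Mod nucleus)" unfolding k using le_imp_power_dvd[of 3 k "2::nat"] by simp
  then have "2 * 8 dvd card nucleus * order (Q Mod nucleus)"
    by (rule mult_dvd_mono[OF even_card_nucleus[OF xyz]])
  then show ?thesis using card_nucleus_Mod[OF assms(2)] by simp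
qed

end
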